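(* Let $(I,\preceq_I,I,\preceq_I,K,\preceq_K,\ast)$ be a tuple in the class $\mathcal C$ with $\ast$ symmetric. Let $a_1\preceq_I a_2\preceq_I\cdots\preceq_I a_{2n}$ be a sequence of $2n$ elements of $I$. Then for all $\sigma\in S_{2n}$, $$\sum_{i=1}^n (a_i\ast a_{2n-i+1})\preceq_K\sum_{i=1}^n (a_{\sigma(2i-1)}\ast a_{\sigma(2i)})\preceq_K\sum_{i=1}^n (a_{2i-1}\ast a_{2i}).$$ If in addition $I=K$ and $a_1\succeq_I 0$, then for all $\sigma\in S_{2n}$, $$\prod^{\ast}_{1\le i\le n} (a_{2i-1}+a_{2i})\preceq_I\prod^{\ast}_{1\le i\le n} (a_{\sigma(2i-1)}+a_{\sigma(2i)})\preceq_I\prod^{\ast}_{1\le i\le n} (a_i+a_{2n-i+1}).$$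
   Context: A partially ordered group $(G,+,\preceq)$ is a group $G$ with operation $+$ and a partial order $\preceq$ such that $z+x\preceq z+y\Leftrightarrow x+z\preceq y+z\Leftrightarrow x\preceq y$ for all $x,y,z\in G$. That $(I,\preceq_I,I,\preceq_I,K,\preceq_K,\ast)$ is in the class $\mathcal C$ means: (1) $(I,+_I,\preceq_I)$ and $(K,+_K,\preceq_K)$ are partially ordered Abelian groups; (2) $\ast:I\times I\to K$ is distributive: $(x+_I y)\ast z=x\ast z+_K y\ast z$ and $x\ast(y+_I z)=x\ast y+_K x\ast z$; (3) $x\succeq_I 0$ and $y\succeq_I 0$ imply $x\ast y\succeq_K 0$. $\ast$ is symmetric if $x\ast y=y\ast x$ for all $x,y$. When $I=K$, $+$ is the group operation and $\prod^{\ast}_{1\le i\le n}x_i$ denotes the iterated product $x_1\ast x_2\ast\cdots\ast x_n$. $S_{2n}$ is the symmetric group on $\{1,\dots,2n\}$.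
   Formalization: In the second part, ∗ is additionally assumed associative when n ≥ 3: without this the unbracketed product x_1∗⋯∗x_n is not well defined, and for left-to-right bracketing the product inequalities can fail. *)

theory Defs
  imports Main "HOL-Combinatorics.Permutations"
begin

text \<open>
  The class \<open>ordered_ab_group_add\<close> is exactly the class of partially ordered Abelian groups (the
  order need not be total). Hence the groups and their orders are carried by the types \<open>'i\<close> and
  \<open>'k\<close>, and the tuple is given by its product operation; the case \<open>I = K\<close> is the case of a product
  of type \<open>'i \<Rightarrow> 'i \<Rightarrow> 'i\<close>.
\<close>

locale class_C =
  fixes star :: "'i::ordered_ab_group_add \<Rightarrow> 'i \<Rightarrow> 'k::ordered_ab_group_add"
  assumes star_add_left: "star (x + y) z = star x z + star y z"
    and star_add_right: "star x (y + z) = star x y + star x z"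
    and star_nonneg: "0 \<le> x \<Longrightarrow> 0 \<le> y \<Longrightarrow> 0 \<le> star x y"

text \<open>
  The product of \<open>x 1, \<dots>, x n\<close>, bracketed to the left. It is meant for \<open>n \<ge> 1\<close> only: there is no
  unit element, so there is no empty product, and the value at \<open>n = 0\<close> is an artefact.
\<close>

definition star_prod :: "('i \<Rightarrow> 'i \<Rightarrow> 'i) \<Rightarrow> (nat \<Rightarrow> 'i) \<Rightarrow> nat \<Rightarrow> 'i" where
  "star_prod star x n = foldl star (x 1) (map x [2..<n + 1])"

end

theory Submission
  imports Defs
begin

text \<open>
  A way of pairing off the elements is recorded as the multiset of pairs of their indices. Replacing
  the pairs \<open>(p, s), (q, r)\<close> with \<open>p \<le> q\<close> and \<open>r \<le> s\<close> by \<open>(p, r), (q, s)\<close> changes the sum of products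
  by \<open>(a q - a p) \<star> (a s - a r) \<succeq> 0\<close>, and the product of the two sums by the negative of this
  quantity. Starting from an arbitrary pairing, such exchanges join the two largest elements, and
  recursively lead to the consecutive pairing; run backwards, they join the smallest element to the
  largest one, and recursively lead to the nested pairing.
\<close>

section \<open>Exchanges in pairings\<close>

text \<open>Pairs are ordered, but a symmetric product and a sum ignore that order;
  \<open>flip\<close> absorbs the difference. Since \<open>step\<close> goes one way only, the
  relation is a preorder that the inequalities can follow.\<close>

inductive exchange :: "('a::linorder \<times> 'a) multiset \<Rightarrow> ('a \<times> 'a) multiset \<Rightarrow> bool" where
  refl: "exchange M M"
| trans: "exchange M N \<Longrightarrow> exchange N L \<Longrightarrow> exchange M L"
| flip: "exchange (add_mset (p, q) N) (add_mset (q, p) N)"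
| step: "p \<le> q \<Longrightarrow> r \<le> s \<Longrightarrow>
    exchange (add_mset (p, s) (add_mset (q, r) N)) (add_mset (p, r) (add_mset (q, s) N))"

declare exchange.trans [trans]

text \<open>\<open>content M = mset_set {1..2 * k}\<close> expresses that \<open>M\<close> is a
  perfect matching of the indices \<open>1, ..., 2 * k\<close>.\<close>

definition content :: "('a \<times> 'a) multiset \<Rightarrow> 'a multiset" where
  "content M = image_mset fst M + image_mset snd M"

lemma content_empty [simp]: "content {#} = {#}"
  by (simp add: content_def)

lemma content_add_mset [simp]:
  "content (add_mset p M) = add_mset (fst p) (add_mset (snd p) (content M))"
  by (simp add: content_def)

lemma content_eq_empty [simp]: "content M = {#} \<longleftrightarrow> M = {#}"
  by (simp add: content_def)

lemma content_image_mset: "content (image_mset (map_prod f f) M) = image_mset f (content M)"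
  by (simp add: content_def multiset.map_comp comp_def)

lemma exchange_add_mset: "exchange M N \<Longrightarrow> exchange (add_mset x M) (add_mset x N)"
proof (induction rule: exchange.induct)
  case (flip p q N)
  show ?case
    using exchange.flip[of p q "add_mset x N"] by (simp add: add_mset_commute)
next
  case (step p q r s N)
  then show ?case
    using exchange.step[of p q r s "add_mset x N"] by (simp add: add_mset_commute)
qed (auto intro: exchange.intros)

lemma exchange_size: "exchange M N \<Longrightarrow> size M = size N"
  by (induction rule: exchange.induct) auto

section \<open>Joining chosen indices by exchanges\<close>

text \<open>A flip is undone by another flip, hence both directions. They serve the two joining
  lemmas below, one leading away from \<open>M\<close> and one leading into it.\<close>

lemma content_extract:
  assumes "u \<in># content M"
  obtains x N where "exchange M (add_mset (u, x) N)" "exchange (add_mset (u, x) N) M"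
    "content M = content (add_mset (u, x) N)"
proof -
  from assms obtain p where p: "p \<in># M" "u = fst p \<or> u = snd p"
    by (auto simp: content_def)
  obtain N where M: "M = add_mset p N"
    using p(1) by (metis mset_add)
  obtain x y where xy: "p = (x, y)" by fastforce
  show thesis
  proof (cases "u = x")
    case True
    then show thesis using that[of y N] M xy by (auto intro: exchange.refl)
  next
    case False
    then have "u = y" using p xy by simp
    then show thesis using that[of x N] M xy by (auto intro: exchange.flip)
  qed
qed

text \<open>Either \<open>u\<close> and \<open>v\<close> are partners or they lie in two pairs; the
  orientation \<open>(u, x)\<close>, \<open>(y, v)\<close> is that of the right-hand side of
  \<open>step\<close>.\<close>

lemma content_extract_two:
  assumes "content M = add_mset u (add_mset v C)"
  obtains
    (together) N where "exchange M (add_mset (u, v) N)" "exchange (add_mset (u, v) N) M"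
      "content N = C"
  | (apart) x y N where "exchange M (add_mset (u, x) (add_mset (y, v) N))"
      "exchange (add_mset (u, x) (add_mset (y, v) N)) M" "C = add_mset x (add_mset y (content N))"
proof -
  obtain x N where xN: "exchange M (add_mset (u, x) N)" "exchange (add_mset (u, x) N) M"
    "content M = content (add_mset (u, x) N)"
    using content_extract[of u M] assms by auto
  then have C: "add_mset v C = add_mset x (content N)"
    using assms by simp
  show thesis
  proof (cases "x = v")
    case True
    then show thesis using together[of N] xN C by simp
  next
    case False
    then have "v \<in># content N"
      using C by (metis insert_noteq_member)
    then obtain y L where yL: "exchange N (add_mset (v, y) L)" "exchange (add_mset (v, y) L) N"
      "content N = content (add_mset (v, y) L)"
      using content_extract by metis
    have "exchange N (add_mset (y, v) L)" "exchange (add_mset (y, v) L) N"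
      using yL exchange.flip exchange.trans by metis+
    then have "exchange M (add_mset (u, x) (add_mset (y, v) L))"
      "exchange (add_mset (u, x) (add_mset (y, v) L)) M"
      using xN exchange_add_mset exchange.trans by metis+
    moreover have "C = add_mset x (add_mset y (content L))"
      using C yL(3) by (simp add: add_mset_commute)
    ultimately show thesis by (rule apart)
  qed
qed

lemma exchange_join_top:
  assumes M: "content M = add_mset u (add_mset v C)"
    and C: "\<And>c. c \<in># C \<Longrightarrow> c \<le> u \<and> c \<le> v"
  obtains N where "content N = C" "exchange M (add_mset (u, v) N)"
  using M
proof (cases rule: content_extract_two)
  case (together N)
  then show thesis using that by simp
next
  case (apart x y N)
  note apart(1)
  also have "exchange (add_mset (u, x) (add_mset (y, v) N)) (add_mset (x, u) (add_mset (v, y) N))"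
    by (rule exchange.trans[OF exchange.flip exchange_add_mset[OF exchange.flip]])
  \<comment> \<open>This is \<open>step\<close> with \<open>p = x\<close>, \<open>q = v\<close>,
    \<open>r = y\<close>, \<open>s = u\<close>; its conditions hold since \<open>u\<close> and
    \<open>v\<close> dominate \<open>C\<close>.\<close>
  also have "exchange (add_mset (x, u) (add_mset (v, y) N))
      (add_mset (x, y) (add_mset (v, u) N))"
    using apart C by (intro exchange.step) auto
  also have "exchange (add_mset (x, y) (add_mset (v, u) N))
      (add_mset (u, v) (add_mset (x, y) N))"
    by (subst add_mset_commute, rule exchange.flip)
  finally have "exchange M (add_mset (u, v) (add_mset (x, y) N))" .
  then show thesis using that[of "add_mset (x, y) N"] apart(3) by simp
qed

lemma exchange_join_ends:
  assumes M: "content M = add_mset u (add_mset v C)"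
    and C: "\<And>c. c \<in># C \<Longrightarrow> u \<le> c \<and> c \<le> v"
  obtains N where "content N = C" "exchange (add_mset (u, v) N) M"
  using M
proof (cases rule: content_extract_two)
  case (together N)
  then show thesis using that by simp
next
  case (apart x y N)
  \<comment> \<open>This is \<open>step\<close> with \<open>p = u\<close>, \<open>q = y\<close>,
    \<open>r = x\<close>, \<open>s = v\<close>: it breaks up the pair of extremes and so leads into
    \<open>M\<close>.\<close>
  have "exchange (add_mset (u, v) (add_mset (y, x) N)) (add_mset (u, x) (add_mset (y, v) N))"
    using apart C by (intro exchange.step) auto
  then have "exchange (add_mset (u, v) (add_mset (y, x) N)) M"
    using apart(2) exchange.trans by metis
  then show thesis using that[of "add_mset (y, x) N"] apart(3) by (simp add: add_mset_commute)
qed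

section \<open>The consecutive, nested and permuted pairings\<close>

lemma exchange_consecutive:
  fixes M :: "(nat \<times> nat) multiset"
  assumes "content M = mset_set {1..2 * k}"
  shows "exchange M (image_mset (\<lambda>i. (2 * i - 1, 2 * i)) (mset_set {1..k}))"
  using assms
proof (induction k arbitrary: M)
  case 0
  then show ?case by (simp add: exchange.refl)
next
  case (Suc k)
  have "{1..2 * Suc k} = insert (2 * k + 1) (insert (2 * k + 2) {1..2 * k})" by auto
  then have "content M = add_mset (2 * k + 1) (add_mset (2 * k + 2) (mset_set {1..2 * k}))"
    using Suc.prems by simp
  then obtain N where N: "content N = mset_set {1..2 * k}"
    "exchange M (add_mset (2 * k + 1, 2 * k + 2) N)"
    by (rule exchange_join_top) auto
  have "{1..Suc k} = insert (Suc k) {1..k}" by auto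
  then show ?case
    using exchange.trans[OF N(2) exchange_add_mset[OF Suc.IH[OF N(1)]]] by simp
qed

text \<open>Once \<open>m\<close> outer pairs are split off, the indices left form the interval from
  \<open>m + 1\<close> to \<open>2 * n - m\<close>. The induction runs down from
  \<open>m = n\<close>, where it is empty, and joins its two ends at each step.\<close>

lemma exchange_nested:
  fixes M :: "(nat \<times> nat) multiset"
  assumes "m \<le> n" "content M = mset_set {m + 1..2 * n - m}"
  shows "exchange (image_mset (\<lambda>i. (i, 2 * n - i + 1)) (mset_set {m + 1..n})) M"
  using assms
proof (induction m arbitrary: M rule: inc_induct)
  case base
  then show ?case by (simp add: exchange.refl)
next
  case (step m)
  have "{m + 1..2 * n - m} = insert (m + 1) (insert (2 * n - m) {Suc m + 1..2 * n - Suc m})"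
    using step.hyps by auto
  \<comment> \<open>The upper end lies outside the inner interval, so \<open>mset_set\<close> splits
    it off; truncated subtraction does no harm since \<open>m < n\<close>.\<close>
  moreover have "\<not> 2 * n - m \<le> 2 * n - Suc m"
    using step.hyps by simp
  ultimately have "content M =
      add_mset (m + 1) (add_mset (2 * n - m) (mset_set {Suc m + 1..2 * n - Suc m}))"
    using step.prems step.hyps by simp
  then obtain N where N: "content N = mset_set {Suc m + 1..2 * n - Suc m}"
    "exchange (add_mset (m + 1, 2 * n - m) N) M"
    by (rule exchange_join_ends) auto
  have "{m + 1..n} = insert (m + 1) {Suc m + 1..n}" using step.hyps by auto
  moreover have "2 * n - (m + 1) + 1 = 2 * n - m" using step.hyps by simp
  ultimately have "image_mset (\<lambda>i. (i, 2 * n - i + 1)) (mset_set {m + 1..n}) =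
      add_mset (m + 1, 2 * n - m)
        (image_mset (\<lambda>i. (i, 2 * n - i + 1)) (mset_set {Suc m + 1..n}))"
    by simp
  then show ?case
    using exchange.trans[OF exchange_add_mset[OF step.IH[OF N(1)]] N(2)] by simp
qed

lemma content_consecutive:
  "content (image_mset (\<lambda>i. (2 * i - 1, 2 * i)) (mset_set {1..k})) = mset_set {1..2 * k :: nat}"
proof (induction k)
  case (Suc k)
  have "{1..2 * Suc k} = insert (2 * k + 1) (insert (2 * k + 2) {1..2 * k})"
    "{1..Suc k} = insert (Suc k) {1..k}" by auto
  then show ?case using Suc by simp
qed simp

text \<open>The permuted pairing is the image of the consecutive one under \<open>\<sigma>\<close>,
  which maps the index set bijectively onto itself.\<close>

lemma content_permuted:
  fixes \<sigma> :: "nat \<Rightarrow> nat"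
  assumes "\<sigma> permutes {1..2 * n}"
  shows "content (image_mset (\<lambda>i. (\<sigma> (2 * i - 1), \<sigma> (2 * i))) (mset_set {1..n})) =
    mset_set {1..2 * n}"
proof -
  have "image_mset (\<lambda>i. (\<sigma> (2 * i - 1), \<sigma> (2 * i))) (mset_set {1..n}) =
      image_mset (map_prod \<sigma> \<sigma>) (image_mset (\<lambda>i. (2 * i - 1, 2 * i)) (mset_set {1..n}))"
    by (simp add: multiset.map_comp comp_def)
  then have "content (image_mset (\<lambda>i. (\<sigma> (2 * i - 1), \<sigma> (2 * i))) (mset_set {1..n})) =
      image_mset \<sigma> (mset_set {1..2 * n})"
    by (simp only: content_image_mset content_consecutive)
  also have "\<dots> = mset_set (\<sigma> ` {1..2 * n})"
    using assms by (intro image_mset_mset_set permutes_inj_on)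
  finally show ?thesis
    using assms by (simp add: permutes_image)
qed

section \<open>Sums and products along an exchange\<close>

context class_C
begin

text \<open>With \<open>q = p + (q - p)\<close> and \<open>s = r + (s - r)\<close>, distributivity
  leaves \<open>star (q - p) (s - r)\<close> as the difference of the two sides.\<close>

lemma star_exchange:
  assumes "p \<le> q" "r \<le> s"
  shows "star p s + star q r \<le> star p r + star q s"
proof -
  have "star q (s - r) = star p (s - r) + star (q - p) (s - r)"
    using star_add_left[of p "q - p" "s - r"] by simp
  moreover have "star p s = star p r + star p (s - r)" "star q s = star q r + star q (s - r)"
    using star_add_right[of _ r "s - r"] by simp_all
  moreover have "0 \<le> star (q - p) (s - r)"
    using assms by (intro star_nonneg) simp_all
  ultimately show ?thesis by (simp add: algebra_simps)
qed

lemma star_mono: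
  assumes "0 \<le> p" "p \<le> q" "0 \<le> r"
  shows "star p r \<le> star q r"
  using star_add_left[of p "q - p" r] star_nonneg[of "q - p" r] assms by simp

lemma sum_exchange_mono:
  fixes a :: "nat \<Rightarrow> 'i"
  assumes "exchange M N" and comm: "\<And>x y. star x y = star y x" and "mono a"
  shows "(\<Sum>(i, j)\<in>#M. star (a i) (a j)) \<le> (\<Sum>(i, j)\<in>#N. star (a i) (a j))"
  using assms(1)
proof (induction rule: exchange.induct)
  case (flip p q N)
  then show ?case by (simp add: comm)
next
  case (step p q r s N)
  then show ?case
    using star_exchange[of "a p" "a q" "a r" "a s"] \<open>mono a\<close>
    by (simp add: add.assoc[symmetric] add_right_mono monoD)
qed auto

end

section \<open>Iterated products and the order of their factors\<close>

definition list_star :: "('a \<Rightarrow> 'a \<Rightarrow> 'a) \<Rightarrow> 'a list \<Rightarrow> 'a" where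
  "list_star f xs = foldl f (hd xs) (tl xs)"

lemma star_prod_eq_list_star:
  assumes "1 \<le> n"
  shows "star_prod f x n = list_star f (map x [1..<n + 1])"
  using assms by (simp add: star_prod_def list_star_def hd_map map_tl upt_conv_Cons numeral_2_eq_2 del: upt_Suc)

text \<open>Two factors can be swapped by commutativity alone. From three on, associativity makes
  right multiplications commute, so that folding over the tail depends only on its multiset.\<close>

lemma list_star_mset_cong:
  assumes comm: "\<And>x y. f x y = f y x"
    and assoc: "3 \<le> length xs \<Longrightarrow> \<forall>x y z. f (f x y) z = f x (f y z)"
    and eq: "mset xs = mset ys"
  shows "list_star f xs = list_star f ys"
proof -
  have len: "length xs = length ys"
    using eq by (rule mset_eq_length)
  consider "length xs \<le> 1" | "length xs = 2" | "3 \<le> length xs" by linarith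
  then show ?thesis
  proof cases
    case 1
    then have "xs = ys"
      using eq by (cases xs) auto
    then show ?thesis by simp
  next
    case 2
    then obtain x y where xs: "xs = [x, y]"
      by (auto simp: length_Suc_conv numeral_2_eq_2)
    obtain u v where ys: "ys = [u, v]"
      using 2 len by (auto simp: length_Suc_conv numeral_2_eq_2)
    have "{#x, y#} = {#u, v#}"
      using eq xs ys by simp
    then have "x = u \<and> y = v \<or> x = v \<and> y = u"
      by (auto simp: add_eq_conv_ex)
    then show ?thesis
      using xs ys comm by (auto simp: list_star_def)
  next
    case 3
    have "f (f z y) x = f (f z x) y" for x y z
      using assoc[OF 3] comm by metis
    then interpret comp_fun_commute "\<lambda>y x. f x y"
      by unfold_locales (auto simp: fun_eq_iff)
    have foldl: "foldl f x zs = fold_mset (\<lambda>y x. f x y) x (mset zs)" for x zs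
      by (induction zs arbitrary: x) (simp_all add: fold_mset_fun_left_comm)
    obtain x xs' where xs: "xs = x # xs'" using 3 by (cases xs) auto
    obtain y ys' where ys: "ys = y # ys'" using 3 len by (cases ys) auto
    have "add_mset x (mset xs') = add_mset y (mset ys')"
      using eq xs ys by simp
    then consider "x = y" "mset xs' = mset ys'"
      | N where "mset xs' = add_mset y N" "mset ys' = add_mset x N"
      by (auto simp: add_eq_conv_ex)
    then show ?thesis
    proof cases
      case 1
      then show ?thesis by (simp add: list_star_def xs ys foldl)
    next
      case 2
      \<comment> \<open>Moving each head to the front of the other tail gives the starting values
        \<open>f x y\<close> and \<open>f y x\<close>, followed by the common factors
        \<open>N\<close>.\<close>
      then show ?thesis
        by (simp add: list_star_def xs ys foldl fold_mset_fun_left_comm) (metis comm)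
    qed
  qed
qed

text \<open>The smaller partial product stays nonnegative after each factor, so
  \<open>star_mono\<close> applies again.\<close>

lemma foldl_star_mono:
  assumes "class_C f" "0 \<le> x" "x \<le> y" "\<And>z. z \<in> set zs \<Longrightarrow> 0 \<le> z"
  shows "foldl f x zs \<le> foldl f y zs"
  using assms(2-)
proof (induction zs arbitrary: x y)
  case (Cons z zs)
  then show ?case
    using class_C.star_mono[OF assms(1)] class_C.star_nonneg[OF assms(1)] by simp
qed simp

text \<open>Products need an order of the factors, hence arbitrary enumerations \<open>ps\<close>
  and \<open>qs\<close>. Reordering puts the two exchanged pairs in front; their product decreases,
  and the remaining nonnegative factors preserve this.\<close>

lemma list_star_exchange_antimono:
  fixes a :: "nat \<Rightarrow> 'i::ordered_ab_group_add"
  assumes "exchange M N" and f: "class_C f" and comm: "\<And>x y. f x y = f y x"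
    and a: "mono a" "\<And>i. 0 \<le> a i"
    and "3 \<le> size M \<Longrightarrow> \<forall>x y z. f (f x y) z = f x (f y z)"
    and "mset ps = M" "mset qs = N"
  shows "list_star f (map (\<lambda>(i, j). a i + a j) qs) \<le> list_star f (map (\<lambda>(i, j). a i + a j) ps)"
  using assms(1,6-)
proof (induction arbitrary: ps qs rule: exchange.induct)
  case (refl M)
  have "length qs = size M"
    using refl.prems(3) by (metis size_mset)
  then have "list_star f (map (\<lambda>(i, j). a i + a j) qs) = list_star f (map (\<lambda>(i, j). a i + a j) ps)"
    using refl.prems by (intro list_star_mset_cong comm) (auto simp only: length_map mset_map)
  then show ?case by simp
next
  case (trans M N L)
  obtain rs where rs: "mset rs = N" using ex_mset by blast
  \<comment> \<open>Exchanges preserve the number of pairs, so associativity carries over to the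
    second exchange.\<close>
  have "\<forall>x y z. f (f x y) z = f x (f y z)" if "3 \<le> size N"
    using that trans.prems(1) exchange_size[OF trans.hyps(1)] by metis
  then show ?case
    using trans.IH(1)[OF trans.prems(1,2) rs] trans.IH(2)[OF _ rs trans.prems(3)]
    by (meson order.trans)
next
  case (flip p q N)
  have "length qs = size (add_mset (p, q) N)"
    using flip.prems(3) by (metis size_mset size_add_mset)
  moreover have "image_mset (\<lambda>(i, j). a i + a j) (mset qs) = image_mset (\<lambda>(i, j). a i + a j) (mset ps)"
    using flip.prems by (simp add: add.commute)
  ultimately have "list_star f (map (\<lambda>(i, j). a i + a j) qs) = list_star f (map (\<lambda>(i, j). a i + a j) ps)"
    using flip.prems(1) by (intro list_star_mset_cong comm) (auto simp only: length_map mset_map)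
  then show ?case by simp
next
  case (step p q r s N)
  let ?h = "\<lambda>(i, j). a i + a j"
  obtain zs where zs: "mset zs = N" using ex_mset by blast
  let ?M = "add_mset (p, s) (add_mset (q, r) N)"
  have len: "length ps = size ?M" "length qs = size ?M"
    using step.prems(2,3) by (metis size_mset size_add_mset)+
  have "mset ps = mset ((p, s) # (q, r) # zs)"
    using step.prems(2) zs by simp
  then have ps: "list_star f (map ?h ps) = list_star f (map ?h ((p, s) # (q, r) # zs))"
    using step.prems(1) len by (intro list_star_mset_cong comm) (auto simp only: length_map mset_map)
  have "mset qs = mset ((p, r) # (q, s) # zs)"
    using step.prems(3) zs by simp
  then have qs: "list_star f (map ?h qs) = list_star f (map ?h ((p, r) # (q, s) # zs))"
    using step.prems(1) len by (intro list_star_mset_cong comm) (auto simp only: length_map mset_map)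
  have "f (a p) (a s) + f (a q) (a r) \<le> f (a p) (a r) + f (a q) (a s)"
    by (intro class_C.star_exchange[OF f] monoD[OF a(1)] step.hyps)
  \<comment> \<open>Expanded, both sides contain \<open>f (a p) (a q)\<close> and
    \<open>f (a r) (a s)\<close>; the other terms are those of the preceding inequality.\<close>
  then have "f (a p + a r) (a q + a s) \<le> f (a p + a s) (a q + a r)"
    by (simp add: class_C.star_add_left[OF f] class_C.star_add_right[OF f] comm[of "a s"]
        comm[of "a r" "a q"] algebra_simps)
  moreover have "0 \<le> f (a p + a r) (a q + a s)"
    using a by (intro class_C.star_nonneg[OF f] add_nonneg_nonneg)
  ultimately have "foldl f (f (a p + a r) (a q + a s)) (map ?h zs) \<le>
      foldl f (f (a p + a s) (a q + a r)) (map ?h zs)"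
    using a by (intro foldl_star_mono[OF f]) auto
  then show ?case
    unfolding ps qs by (simp add: list_star_def)
qed

section \<open>The inequalities for sums and for products\<close>

theorem theorem22:
  fixes a :: "nat \<Rightarrow> 'i::ordered_ab_group_add"
    and n :: nat
    and star :: "'i \<Rightarrow> 'i \<Rightarrow> 'k::ordered_ab_group_add"
    and star' :: "'i \<Rightarrow> 'i \<Rightarrow> 'i"
  assumes "1 \<le> n"
    and "\<And>i. 1 \<le> i \<Longrightarrow> i < 2 * n \<Longrightarrow> a i \<le> a (i + 1)"
  shows "(class_C star \<and> (\<forall>x y. star x y = star y x) \<longrightarrow>
      (\<forall>\<sigma>. \<sigma> permutes {1..2 * n} \<longrightarrow>
        (\<Sum>i = 1..n. star (a i) (a (2 * n - i + 1)))
          \<le> (\<Sum>i = 1..n. star (a (\<sigma> (2 * i - 1))) (a (\<sigma> (2 * i)))) \<and>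
        (\<Sum>i = 1..n. star (a (\<sigma> (2 * i - 1))) (a (\<sigma> (2 * i))))
          \<le> (\<Sum>i = 1..n. star (a (2 * i - 1)) (a (2 * i))))) \<and>
    (class_C star' \<and> (\<forall>x y. star' x y = star' y x) \<and>
     (3 \<le> n \<longrightarrow> (\<forall>x y z. star' (star' x y) z = star' x (star' y z))) \<and> 0 \<le> a 1 \<longrightarrow>
      (\<forall>\<sigma>. \<sigma> permutes {1..2 * n} \<longrightarrow>
        star_prod star' (\<lambda>i. a (2 * i - 1) + a (2 * i)) n
          \<le> star_prod star' (\<lambda>i. a (\<sigma> (2 * i - 1)) + a (\<sigma> (2 * i))) n \<and>
        star_prod star' (\<lambda>i. a (\<sigma> (2 * i - 1)) + a (\<sigma> (2 * i))) n
          \<le> star_prod star' (\<lambda>i. a i + a (2 * n - i + 1)) n))"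
proof -
  \<comment> \<open>Freezing \<open>a\<close> outside \<open>{1..2 * n}\<close> makes it monotone on all indices.\<close>
  define b where "b i = a (max 1 (min i (2 * n)))" for i
  have b_eq: "b i = a i" if "i \<in> {1..2 * n}" for i
    using that by (auto simp: b_def max_def min_def)
  have "b i \<le> b (Suc i)" for i
  proof (cases "1 \<le> i \<and> i < 2 * n")
    case True
    then show ?thesis using assms(2)[of i] by (simp add: b_eq)
  next
    case False
    \<comment> \<open>At \<open>i = 0\<close> both clamped indices are \<open>1\<close>; from
      \<open>2 * n\<close> on both are \<open>2 * n\<close>.\<close>
    then have "max 1 (min i (2 * n)) = max 1 (min (Suc i) (2 * n))" using assms(1) by auto
    then show ?thesis by (simp add: b_def)
  qed
  then have "mono b" by (simp add: mono_iff_le_Suc)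
  let ?nest = "\<lambda>i. (i, 2 * n - i + 1)" and ?cons = "\<lambda>i. (2 * i - 1, 2 * i)"
  let ?perm = "\<lambda>\<sigma> i. (\<sigma> (2 * i - 1), \<sigma> (2 * i))"
  let ?M = "\<lambda>g. image_mset g (mset_set {1..n})" and ?L = "\<lambda>g. map g [1..<n + 1]"
  have exchange: "exchange (?M ?nest) (?M (?perm \<sigma>))" "exchange (?M (?perm \<sigma>)) (?M ?cons)"
    if "\<sigma> permutes {1..2 * n}" for \<sigma>
    using exchange_nested[of 0 n] exchange_consecutive content_permuted[OF that] by simp_all
  have range: "fst (g i) \<in> {1..2 * n} \<and> snd (g i) \<in> {1..2 * n}"
    if "g \<in> {?nest, ?cons, ?perm \<sigma>}" "i \<in> {1..n}" "\<sigma> permutes {1..2 * n}" for g i \<sigma>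
    using that permutes_in_image[OF that(3), of "2 * i - 1"] permutes_in_image[OF that(3), of "2 * i"]
    by auto
  have sum_eq: "(\<Sum>(i, j)\<in>#?M g. star (b i) (b j)) = (\<Sum>i = 1..n. star (a (fst (g i))) (a (snd (g i))))"
    if "g \<in> {?nest, ?cons, ?perm \<sigma>}" "\<sigma> permutes {1..2 * n}" for g \<sigma>
  proof -
    have "(\<Sum>(i, j)\<in>#?M g. star (b i) (b j)) = (\<Sum>i = 1..n. star (b (fst (g i))) (b (snd (g i))))"
      by (simp add: sum_unfold_sum_mset multiset.map_comp comp_def case_prod_beta)
    also have "\<dots> = (\<Sum>i = 1..n. star (a (fst (g i))) (a (snd (g i))))"
      using range[OF that(1) _ that(2)] by (intro sum.cong) (simp_all add: b_eq)
    finally show ?thesis .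
  qed
  have prod_eq: "list_star star' (map (\<lambda>(i, j). b i + b j) (?L g)) =
      star_prod star' (\<lambda>i. a (fst (g i)) + a (snd (g i))) n"
    if "g \<in> {?nest, ?cons, ?perm \<sigma>}" "\<sigma> permutes {1..2 * n}" for g \<sigma>
  proof -
    have "map (\<lambda>(i, j). b i + b j) (?L g) = map (\<lambda>i. a (fst (g i)) + a (snd (g i))) [1..<n + 1]"
      using range[OF that(1) _ that(2)] by (auto simp: b_eq case_prod_beta simp del: upt_Suc)
    then show ?thesis by (simp only: star_prod_eq_list_star[OF assms(1)])
  qed
  have mset_L: "mset (?L g) = ?M g" for g :: "nat \<Rightarrow> nat \<times> nat"
    by (simp add: atLeastLessThanSuc_atLeastAtMost del: upt_Suc)
  show ?thesis
  proof (intro conjI impI allI; elim conjE)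
    fix \<sigma> assume \<sigma>: "\<sigma> permutes {1..2 * n}"
      and star: "class_C star" "\<forall>x y. star x y = star y x"
    note sums = class_C.sum_exchange_mono[OF star(1) _ star(2)[rule_format] \<open>mono b\<close>]
    show "(\<Sum>i = 1..n. star (a i) (a (2 * n - i + 1)))
        \<le> (\<Sum>i = 1..n. star (a (\<sigma> (2 * i - 1))) (a (\<sigma> (2 * i))))"
      using sums[OF exchange(1)[OF \<sigma>]] sum_eq[of ?nest \<sigma>] sum_eq[of "?perm \<sigma>" \<sigma>] \<sigma> by simp
    show "(\<Sum>i = 1..n. star (a (\<sigma> (2 * i - 1))) (a (\<sigma> (2 * i))))
        \<le> (\<Sum>i = 1..n. star (a (2 * i - 1)) (a (2 * i)))"
      using sums[OF exchange(2)[OF \<sigma>]] sum_eq[of ?cons \<sigma>] sum_eq[of "?perm \<sigma>" \<sigma>] \<sigma> by simp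
  next
    fix \<sigma> assume \<sigma>: "\<sigma> permutes {1..2 * n}"
      and star': "class_C star'" "\<forall>x y. star' x y = star' y x"
        "3 \<le> n \<longrightarrow> (\<forall>x y z. star' (star' x y) z = star' x (star' y z))" "0 \<le> a 1"
    \<comment> \<open>The least value of \<open>b\<close> is \<open>b 0 = a 1\<close>.\<close>
    have "0 \<le> b i" for i
      using monoD[OF \<open>mono b\<close>, of 0 i] star'(4) assms(1) by (simp add: b_def)
    \<comment> \<open>Products decrease along exchanges, so the nested pairing, where the chain
      starts, now gives the upper bound.\<close>
    note prods = list_star_exchange_antimono[OF _ star'(1) star'(2)[rule_format] \<open>mono b\<close> this
        _ mset_L mset_L]
    show "star_prod star' (\<lambda>i. a (2 * i - 1) + a (2 * i)) n
        \<le> star_prod star' (\<lambda>i. a (\<sigma> (2 * i - 1)) + a (\<sigma> (2 * i))) n"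
      using prods[OF exchange(2)[OF \<sigma>]] star'(3) prod_eq[of ?cons \<sigma>] prod_eq[of "?perm \<sigma>" \<sigma>] \<sigma>
      by (simp del: upt_Suc)
    show "star_prod star' (\<lambda>i. a (\<sigma> (2 * i - 1)) + a (\<sigma> (2 * i))) n
        \<le> star_prod star' (\<lambda>i. a i + a (2 * n - i + 1)) n"
      using prods[OF exchange(1)[OF \<sigma>]] star'(3) prod_eq[of ?nest \<sigma>] prod_eq[of "?perm \<sigma>" \<sigma>] \<sigma>
      by (simp del: upt_Suc)
  qed
qed

end
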